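(* Let $\Phi$ and $\Psi$ be Orlicz functions and assume that $\Psi$ satisfies $$\limsup_{t\to 0_+}\frac{\Psi(2t)}{\Psi(t)}<+\infty.$$ Let $w=(w_m)_{m\in\mathbb{Z}}$ be a sequence of weights with $w_m>0$ for every $m\in\mathbb{Z}$ and $\inf_{m\in\mathbb{Z}}w_m>0$. Then the following statements hold. (a) If $\Phi(t)\le\Psi(\gamma t)$ for some $\gamma\in(0,1]$ and every $t\in[0,+\infty)$, and if $k''>k'\ge k\ge 0$ are real numbers, then we have the embeddings $$\mathsf{s}_{k'',\Psi,w}\hookrightarrow\mathsf{s}_{k',\Psi,w}\rightarrow\mathsf{s}_{k,\Phi,w},$$ where the first one is compact and the second one continuous. In particular, the embedding $\mathsf{s}_{k'',\Psi,w}\hookrightarrow\mathsf{s}_{k,\Phi,w}$ is compact. (b) If $\Phi(t)\le\Psi(\gamma t)$ for some $\gamma\in(0,+\infty)$ and every $t\in[0,t_0]$ with some $t_0\in(0,+\infty)$, and if $k'>k\ge 0$ are real numbers, then we have the embeddings $$\mathsf{s}_{k',\Psi,w}\hookrightarrow\mathsf{s}_{k,\Psi,w}\rightarrow\mathsf{s}_{\Phi,w},$$ where the first one is compact and the second one continuous. In particular, the embedding $\mathsf{s}_{k',\Psi,w}\hookrightarrow\mathsf{s}_{\Phi,w}$ is compact.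
   Context: An Orlicz function is a continuous, non-decreasing, convex function $\Phi:[0,+\infty)\to[0,+\infty)$ with $\Phi(0)=0$, $\Phi(t)>0$ for every $t>0$ and $\lim_{t\to+\infty}\Phi(t)=+\infty$. Given an Orlicz function $\Phi$, positive weights $w=(w_m)_{m\in\mathbb{Z}}$ and $k\in\mathbb{R}$, the space $\mathsf{s}_{k,\Phi,w}$ consists of all complex sequences $\mathsf{p}=(p_m)_{m\in\mathbb{Z}}$ such that $\sum_{m\in\mathbb{Z}}w_m(1+\Phi(|m|))^k\,\Phi(|p_m|/\rho)<+\infty$ for every $\rho>0$. It is a Banach space under the norm $$\|\mathsf{p}\|_{k,\Phi,w}:=\inf\Big\{\rho>0:\ \sum_{m\in\mathbb{Z}}w_m(1+\Phi(|m|))^k\,\Phi\Big(\frac{|p_m|}{\rho}\Big)\le 1\Big\}.$$ For $k=0$ one writes $\mathsf{s}_{\Phi,w}$ for $\mathsf{s}_{0,\Phi,w}$. The same definitions apply with $\Psi$ in place of $\Phi$ (with $\Psi$ also replacing $\Phi$ in the factor $(1+\Phi(|m|))^k$). An embedding $X\to Y$ between two of these spaces means that $X\subseteq Y$ as sets of sequences, the map being the inclusion; it is continuous if the inclusion is a bounded linear operator, and compact (written $\hookrightarrow$) if the inclusion is a compact linear operator, i.e. maps bounded sets to relatively compact sets. *)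

theory Defs
  imports "HOL-Analysis.Analysis"
begin

text \<open>Only the restriction of an Orlicz function to \<open>{0..}\<close> matters. Its values there are
  nonnegative by the conditions at \<open>0\<close> and on \<open>t > 0\<close>.\<close>

definition orlicz :: "(real \<Rightarrow> real) \<Rightarrow> bool" where
  "orlicz \<Phi> \<longleftrightarrow> continuous_on {0..} \<Phi> \<and> mono_on {0..} \<Phi> \<and> convex_on {0..} \<Phi> \<and>
     \<Phi> 0 = 0 \<and> (\<forall>t>0. \<Phi> t > 0) \<and> filterlim \<Phi> at_top at_top"

definition modular_term ::
    "real \<Rightarrow> (real \<Rightarrow> real) \<Rightarrow> (int \<Rightarrow> real) \<Rightarrow> (int \<Rightarrow> complex) \<Rightarrow> real \<Rightarrow> int \<Rightarrow> real" where
  "modular_term k \<Phi> w p \<rho> m = w m * (1 + \<Phi> \<bar>real_of_int m\<bar>) powr k * \<Phi> (cmod (p m) / \<rho>)"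

definition s_space ::
    "real \<Rightarrow> (real \<Rightarrow> real) \<Rightarrow> (int \<Rightarrow> real) \<Rightarrow> (int \<Rightarrow> complex) set" where
  "s_space k \<Phi> w = {p. \<forall>\<rho>>0. modular_term k \<Phi> w p \<rho> summable_on UNIV}"

text \<open>Since \<open>infsum\<close> is \<open>0\<close> on non-summable families, finiteness of the sum has to be
  required explicitly in \<open>s_norm\<close>.\<close>

definition s_norm ::
    "real \<Rightarrow> (real \<Rightarrow> real) \<Rightarrow> (int \<Rightarrow> real) \<Rightarrow> (int \<Rightarrow> complex) \<Rightarrow> real" where
  "s_norm k \<Phi> w p = Inf {\<rho>. \<rho> > 0 \<and> modular_term k \<Phi> w p \<rho> summable_on UNIV \<and>
      (\<Sum>\<^sub>\<infinity>m. modular_term k \<Phi> w p \<rho> m) \<le> 1}"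

text \<open>The locale \<open>Metric_space\<close> demands symmetry and nonnegativity also off the carrier,
  where \<open>s_norm\<close> may be an unspecified infimum; hence the case distinction.\<close>

definition s_dist ::
    "real \<Rightarrow> (real \<Rightarrow> real) \<Rightarrow> (int \<Rightarrow> real) \<Rightarrow> (int \<Rightarrow> complex) \<Rightarrow> (int \<Rightarrow> complex) \<Rightarrow> real" where
  "s_dist k \<Phi> w p q =
     (if p \<in> s_space k \<Phi> w \<and> q \<in> s_space k \<Phi> w then s_norm k \<Phi> w (\<lambda>m. p m - q m) else 0)"

definition s_topology ::
    "real \<Rightarrow> (real \<Rightarrow> real) \<Rightarrow> (int \<Rightarrow> real) \<Rightarrow> (int \<Rightarrow> complex) topology" where
  "s_topology k \<Phi> w = Metric_space.mtopology (s_space k \<Phi> w) (s_dist k \<Phi> w)"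

definition s_bounded ::
    "real \<Rightarrow> (real \<Rightarrow> real) \<Rightarrow> (int \<Rightarrow> real) \<Rightarrow> (int \<Rightarrow> complex) set \<Rightarrow> bool" where
  "s_bounded k \<Phi> w B \<longleftrightarrow> B \<subseteq> s_space k \<Phi> w \<and> (\<exists>C. \<forall>p\<in>B. s_norm k \<Phi> w p \<le> C)"

text \<open>Inclusions between the spaces. Linearity is automatic, as all of them are linear subspaces
  of the space of complex sequences (see \<open>s_space_add\<close> and \<open>s_space_scale\<close> below). The arguments
  are \<open>(k, \<Phi>)\<close> for the domain, \<open>(l, \<Psi>)\<close> for the codomain, and the common weights.\<close>

definition continuous_embedding ::
    "real \<Rightarrow> (real \<Rightarrow> real) \<Rightarrow> real \<Rightarrow> (real \<Rightarrow> real) \<Rightarrow> (int \<Rightarrow> real) \<Rightarrow> bool" where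
  "continuous_embedding k \<Phi> l \<Psi> w \<longleftrightarrow>
     s_space k \<Phi> w \<subseteq> s_space l \<Psi> w \<and>
     (\<exists>C. \<forall>p \<in> s_space k \<Phi> w. s_norm l \<Psi> w p \<le> C * s_norm k \<Phi> w p)"

definition compact_embedding ::
    "real \<Rightarrow> (real \<Rightarrow> real) \<Rightarrow> real \<Rightarrow> (real \<Rightarrow> real) \<Rightarrow> (int \<Rightarrow> real) \<Rightarrow> bool" where
  "compact_embedding k \<Phi> l \<Psi> w \<longleftrightarrow>
     s_space k \<Phi> w \<subseteq> s_space l \<Psi> w \<and>
     (\<forall>B. s_bounded k \<Phi> w B \<longrightarrow>
        compactin (s_topology l \<Psi> w) ((s_topology l \<Psi> w) closure_of B))"

text \<open>The rest of this theory checks that the definitions above do yield normed spaces.\<close>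

context
  fixes \<Phi> :: "real \<Rightarrow> real" and w :: "int \<Rightarrow> real" and k :: real
  assumes orl: "orlicz \<Phi>" and w_pos: "\<And>m. w m > 0"
begin

lemma orlicz_mono: "0 \<le> x \<Longrightarrow> x \<le> y \<Longrightarrow> \<Phi> x \<le> \<Phi> y"
  using orl mono_onD[of "{0..}" \<Phi> x y] by (simp add: orlicz_def)

lemma orlicz_nonneg: "0 \<le> x \<Longrightarrow> 0 \<le> \<Phi> x"
  using orlicz_mono[of 0 x] orl by (simp add: orlicz_def)

lemma orlicz_convex:
  assumes "0 \<le> u" "0 \<le> v" "u + v = 1" "0 \<le> x" "0 \<le> y"
  shows "\<Phi> (u * x + v * y) \<le> u * \<Phi> x + v * \<Phi> y"
proof -
  have "convex_on {0..} \<Phi>" using orl by (simp add: orlicz_def)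
  then show ?thesis using assms unfolding convex_on_def by auto
qed

lemma factor_pos: "w m * (1 + \<Phi> \<bar>real_of_int m\<bar>) powr k > 0"
  using w_pos[of m] orlicz_nonneg[of "\<bar>real_of_int m\<bar>"] by simp

lemma modular_term_nonneg: "\<rho> > 0 \<Longrightarrow> 0 \<le> modular_term k \<Phi> w p \<rho> m"
  unfolding modular_term_def
  by (intro mult_nonneg_nonneg less_imp_le[OF factor_pos] orlicz_nonneg) auto

lemma modular_term_convex:
  assumes "a > 0" "b > 0"
  shows "modular_term k \<Phi> w (\<lambda>m. p m + q m) (a + b) m \<le>
    a / (a + b) * modular_term k \<Phi> w p a m + b / (a + b) * modular_term k \<Phi> w q b m"
proof -
  have "cmod (p m + q m) / (a + b) \<le> (cmod (p m) + cmod (q m)) / (a + b)"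
    using assms by (intro divide_right_mono norm_triangle_ineq) auto
  also have "\<dots> = a / (a + b) * (cmod (p m) / a) + b / (a + b) * (cmod (q m) / b)"
    using assms by (simp add: add_divide_distrib)
  finally have "\<Phi> (cmod (p m + q m) / (a + b)) \<le>
      \<Phi> (a / (a + b) * (cmod (p m) / a) + b / (a + b) * (cmod (q m) / b))"
    using assms by (intro orlicz_mono) auto
  also have "\<dots> \<le> a / (a + b) * \<Phi> (cmod (p m) / a) + b / (a + b) * \<Phi> (cmod (q m) / b)"
    using assms by (intro orlicz_convex) (auto simp: add_divide_distrib[symmetric])
  finally show ?thesis
    using mult_left_mono[OF _ less_imp_le[OF factor_pos[of m]]]
    unfolding modular_term_def by (fastforce simp: algebra_simps)
qed

lemma s_space_add:
  assumes "p \<in> s_space k \<Phi> w" "q \<in> s_space k \<Phi> w"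
  shows "(\<lambda>m. p m + q m) \<in> s_space k \<Phi> w"
  unfolding s_space_def
proof (intro CollectI allI impI)
  fix \<rho> :: real assume "\<rho> > 0"
  then have h: "\<rho> / 2 > 0" by simp
  have "(\<lambda>m. (\<rho>/2) / (\<rho>/2 + \<rho>/2) * modular_term k \<Phi> w p (\<rho>/2) m +
      (\<rho>/2) / (\<rho>/2 + \<rho>/2) * modular_term k \<Phi> w q (\<rho>/2) m) summable_on UNIV"
    using assms h unfolding s_space_def
    by (intro summable_on_add summable_on_cmult_right) blast+
  then have "modular_term k \<Phi> w (\<lambda>m. p m + q m) (\<rho>/2 + \<rho>/2) summable_on UNIV"
    using h modular_term_convex[OF h h] modular_term_nonneg
    by (elim summable_on_comparison_test) auto
  then show "modular_term k \<Phi> w (\<lambda>m. p m + q m) \<rho> summable_on UNIV" by simp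
qed

lemma modular_term_zero: "modular_term k \<Phi> w (\<lambda>m. 0) \<rho> = (\<lambda>m. 0)"
  using orl by (simp add: modular_term_def orlicz_def fun_eq_iff)

lemma zero_in_s_space: "(\<lambda>m. 0) \<in> s_space k \<Phi> w"
  by (simp add: s_space_def modular_term_zero)

lemma modular_term_scale:
  "c \<noteq> 0 \<Longrightarrow> modular_term k \<Phi> w (\<lambda>m. c * p m) \<rho> = modular_term k \<Phi> w p (\<rho> / cmod c)"
  by (rule ext) (simp add: modular_term_def norm_mult mult.commute)

lemma s_space_scale:
  assumes "p \<in> s_space k \<Phi> w"
  shows "(\<lambda>m. c * p m) \<in> s_space k \<Phi> w"
proof (cases "c = 0")
  case False
  then show ?thesis using assms by (simp add: s_space_def modular_term_scale)
qed (simp add: zero_in_s_space)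

lemma s_space_diff:
  assumes "p \<in> s_space k \<Phi> w" "q \<in> s_space k \<Phi> w"
  shows "(\<lambda>m. p m - q m) \<in> s_space k \<Phi> w"
  using s_space_add[OF assms(1) s_space_scale[OF assms(2), of "-1"]] by simp

definition admissible :: "(int \<Rightarrow> complex) \<Rightarrow> real set" where
  "admissible p = {\<rho>. \<rho> > 0 \<and> modular_term k \<Phi> w p \<rho> summable_on UNIV \<and>
      (\<Sum>\<^sub>\<infinity>m. modular_term k \<Phi> w p \<rho> m) \<le> 1}"

lemma s_norm_admissible: "s_norm k \<Phi> w p = Inf (admissible p)"
  by (simp add: s_norm_def admissible_def)

lemma admissible_bdd: "bdd_below (admissible p)"
  by (rule bdd_belowI[of _ 0]) (auto simp: admissible_def)

lemma admissible_nonempty: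
  assumes "p \<in> s_space k \<Phi> w"
  shows "admissible p \<noteq> {}"
proof -
  define M where "M = (\<Sum>\<^sub>\<infinity>m. modular_term k \<Phi> w p 1 m)"
  define \<rho> where "\<rho> = max 1 M"
  have r: "\<rho> \<ge> 1" "\<rho> \<ge> M" by (auto simp: \<rho>_def)
  have s: "modular_term k \<Phi> w p r summable_on UNIV" if "r > 0" for r
    using assms that by (auto simp: s_space_def)
  have "modular_term k \<Phi> w p \<rho> m \<le> (1 / \<rho>) * modular_term k \<Phi> w p 1 m" for m
  proof -
    have "\<Phi> ((1 / \<rho>) * cmod (p m) + (1 - 1 / \<rho>) * 0) \<le>
        (1 / \<rho>) * \<Phi> (cmod (p m)) + (1 - 1 / \<rho>) * \<Phi> 0"
      using r by (intro orlicz_convex) auto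
    moreover have "\<Phi> 0 = 0" using orl by (simp add: orlicz_def)
    ultimately have "\<Phi> (cmod (p m) / \<rho>) \<le> \<Phi> (cmod (p m)) / \<rho>" by simp
    from mult_left_mono[OF this less_imp_le[OF factor_pos[of m]]]
    show ?thesis by (simp add: modular_term_def)
  qed
  then have "(\<Sum>\<^sub>\<infinity>m. modular_term k \<Phi> w p \<rho> m) \<le> (\<Sum>\<^sub>\<infinity>m. (1 / \<rho>) * modular_term k \<Phi> w p 1 m)"
    using r s by (intro infsum_mono summable_on_cmult_right) auto
  also have "\<dots> = M / \<rho>" unfolding infsum_cmult_right' by (simp add: M_def)
  also have "\<dots> \<le> 1" using r by simp
  finally have "\<rho> \<in> admissible p" using r s by (auto simp: admissible_def)
  then show ?thesis by blast
qed

lemma s_norm_nonneg: "p \<in> s_space k \<Phi> w \<Longrightarrow> 0 \<le> s_norm k \<Phi> w p"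
  unfolding s_norm_admissible
  by (rule cInf_greatest[OF admissible_nonempty]) (auto simp: admissible_def)

lemma s_norm_triangle:
  assumes "p \<in> s_space k \<Phi> w" "q \<in> s_space k \<Phi> w"
  shows "s_norm k \<Phi> w (\<lambda>m. p m + q m) \<le> s_norm k \<Phi> w p + s_norm k \<Phi> w q"
proof -
  have adm: "a + b \<in> admissible (\<lambda>m. p m + q m)" if "a \<in> admissible p" "b \<in> admissible q" for a b
  proof -
    from that have ab: "a > 0" "b > 0" and S: "modular_term k \<Phi> w p a summable_on UNIV"
      "modular_term k \<Phi> w q b summable_on UNIV"
      and le: "(\<Sum>\<^sub>\<infinity>m. modular_term k \<Phi> w p a m) \<le> 1" "(\<Sum>\<^sub>\<infinity>m. modular_term k \<Phi> w q b m) \<le> 1"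
      by (auto simp: admissible_def)
    let ?g = "\<lambda>m. a / (a + b) * modular_term k \<Phi> w p a m + b / (a + b) * modular_term k \<Phi> w q b m"
    have sg: "?g summable_on UNIV" by (intro summable_on_add summable_on_cmult_right S)
    have sf: "modular_term k \<Phi> w (\<lambda>m. p m + q m) (a + b) summable_on UNIV"
      using sg modular_term_convex[OF ab] modular_term_nonneg ab
      by (elim summable_on_comparison_test) auto
    have "(\<Sum>\<^sub>\<infinity>m. modular_term k \<Phi> w (\<lambda>m. p m + q m) (a + b) m) \<le> (\<Sum>\<^sub>\<infinity>m. ?g m)"
      using sf sg modular_term_convex[OF ab] by (intro infsum_mono) auto
    also have "\<dots> = a / (a + b) * (\<Sum>\<^sub>\<infinity>m. modular_term k \<Phi> w p a m) +
        b / (a + b) * (\<Sum>\<^sub>\<infinity>m. modular_term k \<Phi> w q b m)"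
      by (simp add: infsum_add summable_on_cmult_right S infsum_cmult_right' del: times_divide_eq_left)
    also have "\<dots> \<le> a / (a + b) * 1 + b / (a + b) * 1"
      using ab le by (intro add_mono mult_left_mono) auto
    also have "\<dots> = 1" using ab by (simp add: add_divide_distrib[symmetric])
    finally show ?thesis using ab sf by (auto simp: admissible_def)
  qed
  have "s_norm k \<Phi> w (\<lambda>m. p m + q m) - b \<le> s_norm k \<Phi> w p" if b: "b \<in> admissible q" for b
    unfolding s_norm_admissible[of p]
  proof (rule cInf_greatest[OF admissible_nonempty[OF assms(1)]])
    fix a assume "a \<in> admissible p"
    from cInf_lower[OF adm[OF this b] admissible_bdd]
    show "s_norm k \<Phi> w (\<lambda>m. p m + q m) - b \<le> a" by (simp add: s_norm_admissible)
  qed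
  then have "s_norm k \<Phi> w (\<lambda>m. p m + q m) - s_norm k \<Phi> w p \<le> s_norm k \<Phi> w q"
    unfolding s_norm_admissible[of q]
    by (intro cInf_greatest[OF admissible_nonempty[OF assms(2)]]) (simp add: algebra_simps)
  then show ?thesis by simp
qed

lemma s_norm_zero: "s_norm k \<Phi> w (\<lambda>m. 0) = 0"
proof -
  have "admissible (\<lambda>m. 0) = {0<..}"
    by (auto simp: admissible_def modular_term_zero)
  then show ?thesis by (simp add: s_norm_admissible)
qed

lemma s_norm_eq_0:
  assumes "p \<in> s_space k \<Phi> w" "s_norm k \<Phi> w p = 0"
  shows "p = (\<lambda>m. 0)"
proof (rule ccontr)
  assume "p \<noteq> (\<lambda>m. 0)"
  then obtain m where m: "p m \<noteq> 0" by auto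
  define v where "v = w m * (1 + \<Phi> \<bar>real_of_int m\<bar>) powr k"
  have v: "v > 0" unfolding v_def by (rule factor_pos)
  have "eventually (\<lambda>t. \<Phi> t > 1 / v) at_top"
    using orl by (auto simp: orlicz_def filterlim_at_top_dense)
  then obtain T0 where "\<And>t. t \<ge> T0 \<Longrightarrow> \<Phi> t > 1 / v"
    by (auto simp: eventually_at_top_linorder)
  then obtain T where T: "T > 0" "\<And>t. t \<ge> T \<Longrightarrow> \<Phi> t > 1 / v"
    by (metis dual_order.trans linorder_le_cases zero_less_one less_le_trans)
  have "cmod (p m) / T \<le> \<rho>" if "\<rho> \<in> admissible p" for \<rho>
  proof -
    from that have r: "\<rho> > 0" and s: "modular_term k \<Phi> w p \<rho> summable_on UNIV"
      and le: "(\<Sum>\<^sub>\<infinity>m. modular_term k \<Phi> w p \<rho> m) \<le> 1" by (auto simp: admissible_def)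
    have "modular_term k \<Phi> w p \<rho> m \<le> (\<Sum>\<^sub>\<infinity>m. modular_term k \<Phi> w p \<rho> m)"
      using finite_sum_le_infsum[OF s, of "{m}"] modular_term_nonneg[OF r] by simp
    with le have "v * \<Phi> (cmod (p m) / \<rho>) \<le> 1" by (simp add: modular_term_def v_def)
    then have "\<Phi> (cmod (p m) / \<rho>) \<le> 1 / v" using v by (simp add: field_simps)
    then have "cmod (p m) / \<rho> < T" using T(2) by (meson not_le)
    then show ?thesis using r T(1) by (simp add: field_simps)
  qed
  then have "cmod (p m) / T \<le> s_norm k \<Phi> w p"
    unfolding s_norm_admissible by (intro cInf_greatest[OF admissible_nonempty[OF assms(1)]])
  moreover have "cmod (p m) / T > 0" using m T by simp
  ultimately show False using assms(2) by simp
qed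

lemma s_norm_scale:
  assumes p: "p \<in> s_space k \<Phi> w"
  shows "s_norm k \<Phi> w (\<lambda>m. c * p m) = cmod c * s_norm k \<Phi> w p"
proof -
  have le: "s_norm k \<Phi> w (\<lambda>m. c * q m) \<le> cmod c * s_norm k \<Phi> w q"
    if c: "c \<noteq> 0" and q: "q \<in> s_space k \<Phi> w" for c q
  proof -
    have "s_norm k \<Phi> w (\<lambda>m. c * q m) / cmod c \<le> s_norm k \<Phi> w q"
      unfolding s_norm_admissible[of q]
    proof (rule cInf_greatest[OF admissible_nonempty[OF q]])
      fix r assume "r \<in> admissible q"
      then have "cmod c * r \<in> admissible (\<lambda>m. c * q m)"
        using c by (simp add: admissible_def modular_term_scale)
      from cInf_lower[OF this admissible_bdd] 
      show "s_norm k \<Phi> w (\<lambda>m. c * q m) / cmod c \<le> r"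
        using c by (simp add: s_norm_admissible field_simps)
    qed
    then show ?thesis using c by (simp add: field_simps)
  qed
  show ?thesis
  proof (cases "c = 0")
    case True
    then show ?thesis by (simp add: s_norm_zero)
  next
    case False
    have "s_norm k \<Phi> w p \<le> cmod (1 / c) * s_norm k \<Phi> w (\<lambda>m. c * p m)"
      using le[of "1 / c" "\<lambda>m. c * p m"] False s_space_scale[OF p] by simp
    then have "cmod c * s_norm k \<Phi> w p \<le> s_norm k \<Phi> w (\<lambda>m. c * p m)"
      using False by (simp add: norm_divide field_simps)
    with le[OF False p] show ?thesis by simp
  qed
qed

lemma Metric_space_s_space: "Metric_space (s_space k \<Phi> w) (s_dist k \<Phi> w)"
proof
  show "0 \<le> s_dist k \<Phi> w p q" for p q
    by (simp add: s_dist_def s_norm_nonneg s_space_diff)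
  show "s_dist k \<Phi> w p q = s_dist k \<Phi> w q p" for p q
  proof -
    have "modular_term k \<Phi> w (\<lambda>m. p m - q m) = modular_term k \<Phi> w (\<lambda>m. q m - p m)"
      by (simp add: modular_term_def norm_minus_commute fun_eq_iff)
    then show ?thesis by (simp add: s_dist_def s_norm_def)
  qed
  fix p q r assume *: "p \<in> s_space k \<Phi> w" "q \<in> s_space k \<Phi> w"
  show "s_dist k \<Phi> w p q = 0 \<longleftrightarrow> p = q"
  proof
    assume "s_dist k \<Phi> w p q = 0"
    then have "(\<lambda>m. p m - q m) = (\<lambda>m. 0)"
      using * by (intro s_norm_eq_0 s_space_diff) (auto simp: s_dist_def)
    then show "p = q" by (auto simp: fun_eq_iff)
  qed (simp add: s_dist_def s_norm_zero)
  assume "r \<in> s_space k \<Phi> w"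
  then show "s_dist k \<Phi> w p r \<le> s_dist k \<Phi> w p q + s_dist k \<Phi> w q r"
    using s_norm_triangle[OF s_space_diff[OF *] s_space_diff[of q r]] * by (simp add: s_dist_def)
qed

end

end

theory Submission
  imports Defs
begin

text \<open>
  A modular ball \<open>K\<close> of the space of order \<open>l > k\<close> is compact in the space of order \<open>k\<close>. Since the
  weights are bounded below, \<open>K\<close> is coordinatewise bounded, so by Tychonoff a sequence in \<open>K\<close> has a
  coordinatewise convergent subsequence, with limit in \<open>K\<close> by Fatou. Boundedness also confines the
  arguments of the Orlicz function to a fixed interval \<open>[0, R]\<close>, on which the doubling condition at
  \<open>0\<close> gives \<open>\<Phi> (a t) \<le> L \<Phi> t\<close> for every \<open>a\<close>; with the factor \<open>(1 + \<Phi> \<bar>m\<bar>) powr (k - l) \<longlongrightarrow> 0\<close> this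
  makes the tails uniformly small at every scale, and coordinatewise convergence in \<open>K\<close> becomes
  norm convergence. The continuous embeddings compare modulars termwise; under the local
  hypothesis in (b) one first rescales so that all arguments lie in \<open>[0, t0]\<close>, which again
  uses coordinatewise boundedness.
\<close>

section \<open>Modular balls and their relation to the norm\<close>

text \<open>For nonnegative terms, bounding the finite partial sums instead of \<open>infsum\<close>
  builds summability into membership, so termwise comparison and coordinatewise limits involve only
  finite sums.\<close>

definition modular_ball ::
    "real \<Rightarrow> (real \<Rightarrow> real) \<Rightarrow> (int \<Rightarrow> real) \<Rightarrow> real \<Rightarrow> (int \<Rightarrow> complex) set" where
  "modular_ball k \<Phi> w \<rho> = {p. \<forall>F. finite F \<longrightarrow> sum (modular_term k \<Phi> w p \<rho>) F \<le> 1}"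

lemma modular_ball_transfer:
  assumes "p \<in> modular_ball k \<Phi> w \<rho>"
    and "\<And>m. modular_term l \<Psi> w p \<sigma> m \<le> modular_term k \<Phi> w p \<rho> m"
  shows "p \<in> modular_ball l \<Psi> w \<sigma>"
  unfolding modular_ball_def
proof (intro CollectI allI impI)
  fix F :: "int set" assume "finite F"
  have "sum (modular_term l \<Psi> w p \<sigma>) F \<le> sum (modular_term k \<Phi> w p \<rho>) F"
    by (intro sum_mono assms(2))
  also have "\<dots> \<le> 1" using assms(1) \<open>finite F\<close> by (simp add: modular_ball_def)
  finally show "sum (modular_term l \<Psi> w p \<sigma>) F \<le> 1" .
qed

context
  fixes \<Phi> :: "real \<Rightarrow> real" and w :: "int \<Rightarrow> real"
  assumes orl: "orlicz \<Phi>" and w_pos: "\<And>m. w m > 0"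
begin

lemmas Phi_nonneg = orlicz_nonneg[of \<Phi> w, OF orl w_pos]
  and Phi_mono = orlicz_mono[of \<Phi> w, OF orl w_pos]
  and Phi_term_nonneg = modular_term_nonneg[of \<Phi> w, OF orl w_pos]
  and Phi_factor_pos = factor_pos[of \<Phi> w, OF orl w_pos]

lemma modular_ball_iff_infsum:
  assumes "\<rho> > 0"
  shows "p \<in> modular_ball k \<Phi> w \<rho> \<longleftrightarrow> modular_term k \<Phi> w p \<rho> summable_on UNIV \<and>
    (\<Sum>\<^sub>\<infinity>m. modular_term k \<Phi> w p \<rho> m) \<le> 1"
proof
  assume p: "p \<in> modular_ball k \<Phi> w \<rho>"
  then have le: "sum (modular_term k \<Phi> w p \<rho>) F \<le> 1" if "finite F" for F
    using that by (simp add: modular_ball_def)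
  then have "modular_term k \<Phi> w p \<rho> summable_on UNIV"
    using Phi_term_nonneg[OF assms]
    by (intro nonneg_bounded_partial_sums_imp_summable_on[where C = 1]
        eventually_finite_subsets_at_top_weakI) auto
  with le show "modular_term k \<Phi> w p \<rho> summable_on UNIV \<and>
      (\<Sum>\<^sub>\<infinity>m. modular_term k \<Phi> w p \<rho> m) \<le> 1"
    by (auto intro: infsum_le_finite_sums)
next
  assume *: "modular_term k \<Phi> w p \<rho> summable_on UNIV \<and>
    (\<Sum>\<^sub>\<infinity>m. modular_term k \<Phi> w p \<rho> m) \<le> 1"
  show "p \<in> modular_ball k \<Phi> w \<rho>"
    unfolding modular_ball_def
  proof (intro CollectI allI impI)
    fix F :: "int set" assume "finite F"
    with * finite_sum_le_infsum[of "modular_term k \<Phi> w p \<rho>" UNIV F] Phi_term_nonneg[OF assms]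
    show "sum (modular_term k \<Phi> w p \<rho>) F \<le> 1" by auto
  qed
qed

lemma mem_s_space_if_finite_sums_le:
  assumes "\<And>\<rho>. \<rho> > 0 \<Longrightarrow> \<exists>C. \<forall>F. finite F \<longrightarrow> sum (modular_term k \<Phi> w p \<rho>) F \<le> C"
  shows "p \<in> s_space k \<Phi> w"
  unfolding s_space_def
proof (intro CollectI allI impI)
  fix \<rho> :: real assume \<rho>: "\<rho> > 0"
  from assms[OF this] obtain C where "\<And>F. finite F \<Longrightarrow> sum (modular_term k \<Phi> w p \<rho>) F \<le> C"
    by blast
  then show "modular_term k \<Phi> w p \<rho> summable_on UNIV"
    using Phi_term_nonneg[OF \<rho>]
    by (intro nonneg_bounded_partial_sums_imp_summable_on[where C = C]
        eventually_finite_subsets_at_top_weakI) auto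
qed

lemma s_norm_eq_Inf_ball: "s_norm k \<Phi> w p = Inf {\<rho>. \<rho> > 0 \<and> p \<in> modular_ball k \<Phi> w \<rho>}"
  unfolding s_norm_def by (rule arg_cong[where f = Inf]) (auto simp: modular_ball_iff_infsum)

lemma s_norm_le:
  assumes "\<rho> > 0" "p \<in> modular_ball k \<Phi> w \<rho>"
  shows "s_norm k \<Phi> w p \<le> \<rho>"
  unfolding s_norm_eq_Inf_ball
  by (rule cInf_lower) (use assms in \<open>auto intro: bdd_belowI[of _ 0]\<close>)

lemma modular_term_antimono:
  assumes "0 < \<rho>" "\<rho> \<le> \<sigma>"
  shows "modular_term k \<Phi> w p \<sigma> m \<le> modular_term k \<Phi> w p \<rho> m"
  unfolding modular_term_def using assms
  by (intro mult_left_mono Phi_mono less_imp_le[OF Phi_factor_pos]) (auto simp: frac_le)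

lemma modular_ball_mono:
  assumes "0 < \<rho>" "\<rho> \<le> \<sigma>"
  shows "modular_ball k \<Phi> w \<rho> \<subseteq> modular_ball k \<Phi> w \<sigma>"
  by (intro subsetI modular_ball_transfer[OF _ modular_term_antimono[OF assms]])

lemma ex_modular_ball:
  assumes "p \<in> s_space k \<Phi> w"
  shows "{\<rho>. \<rho> > 0 \<and> p \<in> modular_ball k \<Phi> w \<rho>} \<noteq> {}"
  using admissible_nonempty[of \<Phi> w p k, OF orl w_pos assms]
    admissible_def[of \<Phi> w k p, OF orl w_pos] by (auto simp: modular_ball_iff_infsum)

text \<open>An infimum below \<rho> leaves some admissible radius below \<rho>, and balls grow with
  the radius. The strict inequality avoids the question whether the infimum is attained.\<close>

lemma modular_ball_if_s_norm_less:
  assumes "p \<in> s_space k \<Phi> w" "s_norm k \<Phi> w p < \<rho>"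
  shows "p \<in> modular_ball k \<Phi> w \<rho>"
proof -
  have "\<exists>\<sigma>\<in>{\<rho>. \<rho> > 0 \<and> p \<in> modular_ball k \<Phi> w \<rho>}. \<sigma> < \<rho>"
    using assms(2) unfolding s_norm_eq_Inf_ball by (intro cInf_lessD ex_modular_ball[OF assms(1)])
  then show ?thesis using modular_ball_mono[of _ \<rho> k] by force
qed

text \<open>Convexity with both weights equal to 1/2. It keeps the differences between a sequence in
  a ball and its limit in the ball of twice the radius.\<close>

lemma modular_ball_diff:
  assumes "\<rho> > 0" "p \<in> modular_ball k \<Phi> w \<rho>" "q \<in> modular_ball k \<Phi> w \<rho>"
  shows "(\<lambda>m. p m - q m) \<in> modular_ball k \<Phi> w (2 * \<rho>)"
  unfolding modular_ball_def
proof (intro CollectI allI impI)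
  fix F :: "int set" assume F: "finite F"
  have minus: "modular_term k \<Phi> w (\<lambda>m. - q m) \<rho> = modular_term k \<Phi> w q \<rho>"
    by (simp add: modular_term_def fun_eq_iff)
  have "modular_term k \<Phi> w (\<lambda>m. p m - q m) (2 * \<rho>) m \<le>
      1/2 * modular_term k \<Phi> w p \<rho> m + 1/2 * modular_term k \<Phi> w q \<rho> m" for m
    using modular_term_convex[of \<Phi> w \<rho> \<rho> k p "\<lambda>m. - q m", OF orl w_pos] assms(1)
    by (simp add: minus flip: mult_2)
  then have "sum (modular_term k \<Phi> w (\<lambda>m. p m - q m) (2 * \<rho>)) F \<le>
      1/2 * sum (modular_term k \<Phi> w p \<rho>) F + 1/2 * sum (modular_term k \<Phi> w q \<rho>) F"
    unfolding sum_distrib_left sum.distrib[symmetric] by (intro sum_mono) auto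
  also have "\<dots> \<le> 1/2 * 1 + 1/2 * 1"
    using assms F unfolding modular_ball_def by (intro add_mono mult_left_mono) auto
  finally show "sum (modular_term k \<Phi> w (\<lambda>m. p m - q m) (2 * \<rho>)) F \<le> 1" by simp
qed

section \<open>Coordinate bounds and consequences of the doubling condition\<close>

lemma orlicz_sublevel_bounded:
  assumes "c > 0"
  obtains R where "R > 0" "\<And>t. t \<ge> 0 \<Longrightarrow> c * \<Phi> t \<le> 1 \<Longrightarrow> t \<le> R"
proof -
  have "eventually (\<lambda>t. \<Phi> t > 1 / c \<and> t > 0) at_top"
    using orl by (intro eventually_conj eventually_gt_at_top)
      (auto simp: orlicz_def filterlim_at_top_dense)
  then obtain R where R: "\<Phi> R > 1 / c" "R > 0"
    by (auto simp: eventually_at_top_linorder)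
  have "t \<le> R" if "t \<ge> 0" "c * \<Phi> t \<le> 1" for t
  proof (rule ccontr)
    assume "\<not> t \<le> R"
    with Phi_mono[of R t] R(2) have "\<Phi> R \<le> \<Phi> t" by simp
    with assms have "c * \<Phi> R \<le> c * \<Phi> t" by simp
    with R(1) that(2) assms show False by (simp add: field_simps)
  qed
  with R(2) that show thesis by blast
qed

lemma factor_mono: "k \<le> l \<Longrightarrow> (1 + \<Phi> \<bar>real_of_int m\<bar>) powr k \<le> (1 + \<Phi> \<bar>real_of_int m\<bar>) powr l"
  using Phi_nonneg[of "\<bar>real_of_int m\<bar>"] by (intro powr_mono) auto

text \<open>A single modular term is at most 1, and the factor in front of \<Phi> is at least
  \<open>c\<close>, since its base is at least 1 and \<open>k\<close> is nonnegative. The growth of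
  \<Phi> then bounds the argument. \<open>R\<close> is chosen before \<rho>, so it serves all radii
  at once.\<close>

lemma modular_ball_ptwise_le:
  assumes c: "c > 0" "\<And>m. c \<le> w m" and k: "k \<ge> 0"
  shows "\<exists>R>0. \<forall>\<rho>>0. \<forall>p\<in>modular_ball k \<Phi> w \<rho>. \<forall>m. cmod (p m) / \<rho> \<le> R"
proof -
  from orlicz_sublevel_bounded[OF c(1)] obtain R
    where R: "R > 0" "\<And>t. t \<ge> 0 \<Longrightarrow> c * \<Phi> t \<le> 1 \<Longrightarrow> t \<le> R" by blast
  have "cmod (p m) / \<rho> \<le> R" if *: "\<rho> > 0" "p \<in> modular_ball k \<Phi> w \<rho>" for \<rho> p m
  proof (rule R(2))
    have "c * 1 \<le> w m * (1 + \<Phi> \<bar>real_of_int m\<bar>) powr k"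
      using factor_mono[OF k, of m] Phi_nonneg[of "\<bar>real_of_int m\<bar>"] c w_pos[of m]
      by (intro mult_mono) auto
    from mult_right_mono[OF this, of "\<Phi> (cmod (p m) / \<rho>)"] *(1)
    have "c * \<Phi> (cmod (p m) / \<rho>) \<le> modular_term k \<Phi> w p \<rho> m"
      by (simp add: modular_term_def Phi_nonneg)
    also have "\<dots> \<le> 1"
      using *(2) unfolding modular_ball_def by (force dest: spec[of _ "{m}"])
    finally show "c * \<Phi> (cmod (p m) / \<rho>) \<le> 1" .
  qed (use * in auto)
  with R(1) show ?thesis by blast
qed

text \<open>The limsup controls the quotient on some \<open>(0, d)\<close>; on \<open>[d, R]\<close>
  monotonicity bounds it by \<open>\<Phi> (2 * R) / \<Phi> d\<close>.\<close>

lemma doubling_bounded: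
  assumes limsup: "Limsup (at_right 0) (\<lambda>t. ereal (\<Phi> (2 * t) / \<Phi> t)) < \<infinity>"
  shows "\<exists>L. \<forall>t\<in>{0..R}. \<Phi> (2 * t) \<le> L * \<Phi> t"
proof -
  have pos: "\<Phi> t > 0" if "t > 0" for t
    using orl that by (auto simp: orlicz_def)
  obtain K where "Limsup (at_right 0) (\<lambda>t. ereal (\<Phi> (2 * t) / \<Phi> t)) < ereal K"
    using limsup less_PInf_Ex_of_nat by auto
  then have "eventually (\<lambda>t. ereal (\<Phi> (2 * t) / \<Phi> t) < ereal K) (at_right 0)"
    by (rule Limsup_lessD)
  then obtain d where d: "d > 0" "\<And>t. 0 < t \<Longrightarrow> t < d \<Longrightarrow> \<Phi> (2 * t) / \<Phi> t < K"
    by (auto simp: eventually_at_right_field)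
  have "\<Phi> (2 * t) \<le> max K (\<Phi> (2 * R) / \<Phi> d) * \<Phi> t" if t: "t \<in> {0..R}" for t
  proof -
    consider "t = 0" | "0 < t" "t < d" | "d \<le> t" using t by force
    then show ?thesis
    proof cases
      case 1
      then show ?thesis using orl by (simp add: orlicz_def)
    next
      case 2
      then have "\<Phi> (2 * t) \<le> K * \<Phi> t" using d(2)[of t] pos[of t] by (simp add: field_simps)
      also have "\<dots> \<le> max K (\<Phi> (2 * R) / \<Phi> d) * \<Phi> t"
        using pos[of t] 2 by (intro mult_right_mono) auto
      finally show ?thesis .
    next
      case 3
      have "\<Phi> (2 * t) \<le> \<Phi> (2 * R)" using t by (intro Phi_mono) auto
      also have "\<dots> = \<Phi> (2 * R) / \<Phi> d * \<Phi> d" using pos[OF d(1)] by simp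
      also have "\<dots> \<le> max K (\<Phi> (2 * R) / \<Phi> d) * \<Phi> t"
        using t 3 d(1) pos[of d] Phi_nonneg[of "2 * R"]
        by (intro mult_mono Phi_mono) (auto simp: le_max_iff_disj Phi_nonneg)
      finally show ?thesis .
    qed
  qed
  then show ?thesis by blast
qed

text \<open>Doubling is iterated until \<open>2 ^ n\<close> exceeds \<open>a\<close>; monotonicity
  does the rest.\<close>

lemma dilation_bounded:
  assumes limsup: "Limsup (at_right 0) (\<lambda>t. ereal (\<Phi> (2 * t) / \<Phi> t)) < \<infinity>" and a: "a \<ge> 0"
  obtains L where "L > 0" "\<And>t. 0 \<le> t \<Longrightarrow> t \<le> R \<Longrightarrow> \<Phi> (a * t) \<le> L * \<Phi> t"
proof -
  have pow: "\<exists>L\<ge>0. \<forall>t\<in>{0..R}. \<Phi> (2 ^ n * t) \<le> L * \<Phi> t" for n R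
  \<comment> \<open>The interval must vary: for \<open>t\<close> in \<open>[0, R]\<close> the
    induction hypothesis is applied to \<open>2 * t\<close>, which lies in
    \<open>[0, 2 * R]\<close>.\<close>
  proof (induction n arbitrary: R)
    case 0
    show ?case by (rule exI[of _ 1]) auto
  next
    case (Suc n)
    from Suc[of "2 * R"] obtain L where L: "L \<ge> 0" "\<And>t. t \<in> {0..2*R} \<Longrightarrow> \<Phi> (2 ^ n * t) \<le> L * \<Phi> t"
      by blast
    from doubling_bounded[OF limsup] obtain K where K: "\<And>t. t \<in> {0..R} \<Longrightarrow> \<Phi> (2 * t) \<le> K * \<Phi> t"
      by blast
    \<comment> \<open>\<open>doubling_bounded\<close> gives no sign for \<open>K\<close>; the
      absolute value keeps the new constant nonnegative.\<close>
    have "\<Phi> (2 ^ Suc n * t) \<le> L * \<bar>K\<bar> * \<Phi> t" if t: "t \<in> {0..R}" for t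
    proof -
      have "\<Phi> (2 ^ Suc n * t) \<le> L * \<Phi> (2 * t)" using L(2)[of "2 * t"] t by (simp add: mult_ac)
      also have "\<dots> \<le> L * (\<bar>K\<bar> * \<Phi> t)"
        using order_trans[OF K[OF t] mult_right_mono[OF abs_ge_self Phi_nonneg]] L(1) t
        by (intro mult_left_mono) auto
      finally show ?thesis by (simp add: mult_ac)
    qed
    with L(1) show ?case by (intro exI[of _ "L * \<bar>K\<bar>"]) auto
  qed
  obtain n :: nat where n: "\<bar>a\<bar> < 2 ^ n" using real_arch_pow[of 2 "\<bar>a\<bar>"] by auto
  from pow[of R n] obtain L where L: "L \<ge> 0" "\<And>t. t \<in> {0..R} \<Longrightarrow> \<Phi> (2 ^ n * t) \<le> L * \<Phi> t"
    by blast
  \<comment> \<open>Adding 1 makes the constant strictly positive, so that it can be divided by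
    later.\<close>
  have "\<Phi> (a * t) \<le> (L + 1) * \<Phi> t" if t: "0 \<le> t" "t \<le> R" for t
  proof -
    have "\<Phi> (a * t) \<le> \<Phi> (2 ^ n * t)"
      using n t(1) a by (intro Phi_mono mult_right_mono) auto
    also have "\<dots> \<le> (L + 1) * \<Phi> t" using L(2)[of t] t Phi_nonneg[of t] by (simp add: algebra_simps)
    finally show ?thesis .
  qed
  with L(1) that[of "L + 1"] show thesis by simp
qed

section \<open>Coordinatewise limits in modular balls\<close>

lemma tendsto_modular_term:
  assumes "(\<lambda>n. q n m) \<longlonglongrightarrow> p m" "\<rho> > 0"
  shows "(\<lambda>n. modular_term k \<Phi> w (q n) \<rho> m) \<longlonglongrightarrow> modular_term k \<Phi> w p \<rho> m"
proof -
  have cont: "continuous_on {0..} \<Phi>" using orl by (simp add: orlicz_def)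
  have "(\<lambda>n. \<Phi> (cmod (q n m) / \<rho>)) \<longlonglongrightarrow> \<Phi> (cmod (p m) / \<rho>)"
    by (rule continuous_on_tendsto_compose[OF cont])
      (use assms in \<open>auto intro!: tendsto_intros\<close>)
  then show ?thesis unfolding modular_term_def by (intro tendsto_intros)
qed

text \<open>Fatou's lemma in finite form: each finite partial sum is continuous under coordinatewise
  convergence, so the bound 1 passes to the limit.\<close>

lemma modular_ball_ptwise_closed:
  assumes "\<And>n. q n \<in> modular_ball k \<Phi> w \<rho>" "\<And>m. (\<lambda>n. q n m) \<longlonglongrightarrow> p m" "\<rho> > 0"
  shows "p \<in> modular_ball k \<Phi> w \<rho>"
  unfolding modular_ball_def
proof (intro CollectI allI impI)
  fix F :: "int set" assume "finite F"
  moreover have "(\<lambda>n. sum (modular_term k \<Phi> w (q n) \<rho>) F) \<longlonglongrightarrow> sum (modular_term k \<Phi> w p \<rho>) F"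
    by (intro tendsto_sum tendsto_modular_term assms)
  ultimately show "sum (modular_term k \<Phi> w p \<rho>) F \<le> 1"
    using assms(1) unfolding modular_ball_def by (intro LIMSEQ_le_const2) auto
qed

lemma s_space_mono: "k \<le> l \<Longrightarrow> s_space l \<Phi> w \<subseteq> s_space k \<Phi> w"
proof
  fix p assume kl: "k \<le> l" and p: "p \<in> s_space l \<Phi> w"
  have "modular_term k \<Phi> w p \<rho> m \<le> modular_term l \<Phi> w p \<rho> m" if "\<rho> > 0" for \<rho> m
    unfolding modular_term_def using that w_pos[of m]
    by (intro mult_right_mono mult_left_mono factor_mono[OF kl] Phi_nonneg) auto
  with p show "p \<in> s_space k \<Phi> w"
    unfolding s_space_def by (auto intro: summable_on_comparison_test Phi_term_nonneg)
qed

lemma modular_ball_seq_compact: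
  assumes c: "c > 0" "\<And>m. c \<le> w m" and k: "k \<ge> 0" and \<rho>: "\<rho> > 0"
    and q: "\<And>n. q n \<in> modular_ball k \<Phi> w \<rho>"
  shows "\<exists>p\<in>modular_ball k \<Phi> w \<rho>. \<exists>r::nat \<Rightarrow> nat. strict_mono r \<and> (\<forall>m. (\<lambda>n. q (r n) m) \<longlonglongrightarrow> p m)"
proof -
  obtain R where R: "R > 0"
    "\<And>\<rho> p m. \<rho> > 0 \<Longrightarrow> p \<in> modular_ball k \<Phi> w \<rho> \<Longrightarrow> cmod (p m) / \<rho> \<le> R"
    using modular_ball_ptwise_le[OF c k] by blast
  from R(2)[OF \<rho> q] have bound: "cmod (q n m) \<le> R * \<rho>" for n m using \<rho> by (simp add: field_simps)
  \<comment> \<open>The coordinate bound places the sequence in a product of discs, compact by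
    Tychonoff. The countable index set makes the product first countable, so compactness yields
    convergent subsequences.\<close>
  have "compactin (product_topology (\<lambda>_. euclidean) UNIV)
      (PiE UNIV (\<lambda>_::int. cball (0::complex) (R * \<rho>)))"
    by (simp add: compactin_PiE)
  then have "seq_compact (PiE UNIV (\<lambda>_::int. cball (0::complex) (R * \<rho>)))"
    by (simp add: euclidean_product_topology compact_imp_seq_compact)
  moreover have "\<forall>n. q n \<in> PiE UNIV (\<lambda>_. cball 0 (R * \<rho>))" using bound by auto
  ultimately obtain p and r :: "nat \<Rightarrow> nat" where pr: "strict_mono r" "(q \<circ> r) \<longlonglongrightarrow> p"
    by (elim seq_compactE)
  have lim: "(\<lambda>n. q (r n) m) \<longlonglongrightarrow> p m" for m
    using continuous_on_tendsto_compose[OF continuous_on_product_coordinates pr(2), of m] by simp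
  have "p \<in> modular_ball k \<Phi> w \<rho>"
    using modular_ball_ptwise_closed[of "\<lambda>n. q (r n)"] q lim \<rho> by blast
  with pr(1) lim show ?thesis by blast
qed

section \<open>Compactness of modular balls under the doubling condition\<close>

context
  fixes c :: real
  assumes limsup: "Limsup (at_right 0) (\<lambda>t. ereal (\<Phi> (2 * t) / \<Phi> t)) < \<infinity>"
    and c: "c > 0" "\<And>m. c \<le> w m"
begin

text \<open>Write \<open>cmod (p m) / \<sigma>\<close> as \<open>\<rho> / \<sigma>\<close> times
  \<open>cmod (p m) / \<rho>\<close>, where the second factor stays in a fixed
  \<open>[0, R]\<close>. The order \<open>l\<close> of the terms may differ from the order
  \<open>k\<close> of the ball because the weight factor is the same on both sides.\<close>

lemma modular_term_dilation_le:
  assumes "k \<ge> 0" "\<rho> > 0" "\<sigma> > 0"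
  obtains L where "L > 0"
    "\<And>p m. p \<in> modular_ball k \<Phi> w \<rho> \<Longrightarrow>
      modular_term l \<Phi> w p \<sigma> m \<le> L * modular_term l \<Phi> w p \<rho> m"
proof -
  obtain R where R: "R > 0"
    "\<And>\<rho> p m. \<rho> > 0 \<Longrightarrow> p \<in> modular_ball k \<Phi> w \<rho> \<Longrightarrow> cmod (p m) / \<rho> \<le> R"
    using modular_ball_ptwise_le[OF c assms(1)] by blast
  obtain L where L: "L > 0" "\<And>t. 0 \<le> t \<Longrightarrow> t \<le> R \<Longrightarrow> \<Phi> (\<rho> / \<sigma> * t) \<le> L * \<Phi> t"
    using dilation_bounded[OF limsup, of "\<rho> / \<sigma>" R] assms by auto
  have "modular_term l \<Phi> w p \<sigma> m \<le> L * modular_term l \<Phi> w p \<rho> m"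
    if "p \<in> modular_ball k \<Phi> w \<rho>" for p m
  proof -
    have "\<Phi> (cmod (p m) / \<sigma>) \<le> L * \<Phi> (cmod (p m) / \<rho>)"
      using L(2)[OF _ R(2)[OF assms(2) that], of m] assms by simp
    from mult_left_mono[OF this less_imp_le[OF Phi_factor_pos[of m l]]]
    show ?thesis by (simp add: modular_term_def mult_ac)
  qed
  with L(1) that show thesis by blast
qed

text \<open>The ball controls the scale \<rho> only, while the space asks for summability at every
  scale \<sigma>; the dilation constant \<open>L\<close> bounds the partial sums at scale
  \<sigma>.\<close>

lemma modular_ball_subset_s_space:
  assumes "k \<ge> 0" "\<rho> > 0"
  shows "modular_ball k \<Phi> w \<rho> \<subseteq> s_space k \<Phi> w"
proof
  fix p assume p: "p \<in> modular_ball k \<Phi> w \<rho>"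
  show "p \<in> s_space k \<Phi> w"
  proof (rule mem_s_space_if_finite_sums_le)
    fix \<sigma> :: real assume "\<sigma> > 0"
    then obtain L where L: "L > 0"
      "\<And>m. modular_term k \<Phi> w p \<sigma> m \<le> L * modular_term k \<Phi> w p \<rho> m"
      using modular_term_dilation_le[OF assms, of \<sigma> k] p by metis
    have "sum (modular_term k \<Phi> w p \<sigma>) F \<le> L * 1" if "finite F" for F
    proof -
      have "sum (modular_term k \<Phi> w p \<sigma>) F \<le> L * sum (modular_term k \<Phi> w p \<rho>) F"
        unfolding sum_distrib_left by (intro sum_mono L(2))
      also have "\<dots> \<le> L * 1"
        using p that L(1) by (intro mult_left_mono) (auto simp: modular_ball_def)
      finally show ?thesis .
    qed
    then show "\<exists>C. \<forall>F. finite F \<longrightarrow> sum (modular_term k \<Phi> w p \<sigma>) F \<le> C" by blast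
  qed
qed

text \<open>The modular at scale \<epsilon> is split into a finite window and a tail, each
  contributing at most 1/2. On the tail the decay of
  \<open>(1 + \<Phi> \<bar>m\<bar>) powr (k - l)\<close> beats the cost \<open>L\<close> of passing
  from scale \<rho> to scale \<epsilon>; on the window coordinatewise convergence suffices.\<close>

lemma eventually_s_norm_le:
  assumes kl: "0 \<le> k" "k < l" and \<rho>: "\<rho> > 0" and \<epsilon>: "\<epsilon> > 0"
    and q: "\<And>n. q n \<in> modular_ball l \<Phi> w \<rho>" and lim: "\<And>m. (\<lambda>n. q n m) \<longlonglongrightarrow> 0"
  shows "eventually (\<lambda>n. s_norm k \<Phi> w (q n) \<le> \<epsilon>) sequentially"
proof -
  have "l \<ge> 0" using kl by simp
  then obtain L where L: "L > 0" "\<And>p m. p \<in> modular_ball l \<Phi> w \<rho> \<Longrightarrow>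
      modular_term l \<Phi> w p \<epsilon> m \<le> L * modular_term l \<Phi> w p \<rho> m"
    using modular_term_dilation_le[of l \<rho> \<epsilon> l] \<rho> \<epsilon> by blast
  have "filterlim (\<lambda>x. 1 + \<Phi> x) at_top at_top"
    using orl by (auto simp: orlicz_def intro: filterlim_tendsto_add_at_top)
  then have "((\<lambda>x. (1 + \<Phi> x) powr (k - l)) \<longlongrightarrow> 0) at_top"
    using kl by (intro tendsto_neg_powr) auto
  \<comment> \<open>Multiplied by the dilation cost \<open>L\<close>, this threshold leaves the
    factor 1/2.\<close>
  then have "eventually (\<lambda>x. (1 + \<Phi> x) powr (k - l) < 1 / (2 * L)) at_top"
    using L(1) by (intro order_tendstoD) auto
  then obtain N where N: "\<And>x. x \<ge> N \<Longrightarrow> (1 + \<Phi> x) powr (k - l) < 1 / (2 * L)"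
    by (auto simp: eventually_at_top_linorder)
  \<comment> \<open>Every index outside the window has absolute value at least \<open>N\<close>;
    this also holds for negative \<open>N\<close>, where the window may be empty.\<close>
  define A where "A = {- \<lceil>N\<rceil>..\<lceil>N\<rceil>}"
  have tail: "modular_term k \<Phi> w (q n) \<epsilon> m \<le> 1/2 * modular_term l \<Phi> w (q n) \<rho> m"
    if "m \<notin> A" for n m
  proof -
    have m: "N \<le> \<bar>real_of_int m\<bar>" using that unfolding A_def by (auto simp: abs_if) linarith+
    have "(1 + \<Phi> \<bar>real_of_int m\<bar>) powr k =
        (1 + \<Phi> \<bar>real_of_int m\<bar>) powr (k - l) * (1 + \<Phi> \<bar>real_of_int m\<bar>) powr l"
      by (simp flip: powr_add)
    then have "modular_term k \<Phi> w (q n) \<epsilon> m =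
        (1 + \<Phi> \<bar>real_of_int m\<bar>) powr (k - l) * modular_term l \<Phi> w (q n) \<epsilon> m"
      by (simp add: modular_term_def mult_ac)
    also have "\<dots> \<le> 1 / (2 * L) * (L * modular_term l \<Phi> w (q n) \<rho> m)"
      using N[OF m] L q Phi_term_nonneg[OF \<epsilon>] by (intro mult_mono) auto
    finally show ?thesis using L(1) by simp
  qed
  have "(\<lambda>n. sum (modular_term k \<Phi> w (q n) \<epsilon>) A) \<longlonglongrightarrow> sum (modular_term k \<Phi> w (\<lambda>m. 0) \<epsilon>) A"
    by (intro tendsto_sum tendsto_modular_term lim \<epsilon>)
  then have "(\<lambda>n. sum (modular_term k \<Phi> w (q n) \<epsilon>) A) \<longlonglongrightarrow> 0"
    using modular_term_zero[of \<Phi> w k \<epsilon>, OF orl w_pos] by simp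
  then have "eventually (\<lambda>n. sum (modular_term k \<Phi> w (q n) \<epsilon>) A < 1/2) sequentially"
    by (intro order_tendstoD) auto
  then show ?thesis
  proof eventually_elim
    case (elim n)
    show ?case
    proof (rule s_norm_le[OF \<epsilon>])
      have "sum (modular_term k \<Phi> w (q n) \<epsilon>) F \<le> 1" if F: "finite F" for F
      proof -
        have "sum (modular_term k \<Phi> w (q n) \<epsilon>) F =
            sum (modular_term k \<Phi> w (q n) \<epsilon>) (F \<inter> A) + sum (modular_term k \<Phi> w (q n) \<epsilon>) (F - A)"
          using F by (rule sum.Int_Diff)
        also have "\<dots> \<le> sum (modular_term k \<Phi> w (q n) \<epsilon>) A +
            1/2 * sum (modular_term l \<Phi> w (q n) \<rho>) (F - A)"
          unfolding sum_distrib_left using tail Phi_term_nonneg[OF \<epsilon>]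
          by (intro add_mono sum_mono2 sum_mono) (auto simp: A_def)
        also have "\<dots> \<le> 1/2 + 1/2 * 1"
          using elim q[of n] F by (intro add_mono mult_left_mono) (auto simp: modular_ball_def)
        finally show ?thesis by simp
      qed
      then show "q n \<in> modular_ball k \<Phi> w \<epsilon>" by (simp add: modular_ball_def)
    qed
  qed
qed

text \<open>In a metric space sequential compactness suffices. The coordinatewise limit of a
  subsequence lies in the ball; the differences lie in the ball of twice the radius and tend to 0 in
  each coordinate, hence in the norm of lower order.\<close>

lemma compactin_modular_ball:
  assumes kl: "0 \<le> k" "k < l" and \<rho>: "\<rho> > 0"
  shows "compactin (s_topology k \<Phi> w) (modular_ball l \<Phi> w \<rho>)"
proof -
  interpret Metric_space "s_space k \<Phi> w" "s_dist k \<Phi> w"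
    by (rule Metric_space_s_space[OF orl w_pos])
  have l: "l \<ge> 0" using kl by simp
  have sub: "modular_ball l \<Phi> w \<rho> \<subseteq> s_space k \<Phi> w"
    using modular_ball_subset_s_space[OF l \<rho>] s_space_mono[of k l] kl by auto
  have "\<exists>p r. p \<in> modular_ball l \<Phi> w \<rho> \<and> strict_mono r \<and> limitin mtopology (q \<circ> r) p sequentially"
    if q: "range q \<subseteq> modular_ball l \<Phi> w \<rho>" for q :: "nat \<Rightarrow> int \<Rightarrow> complex"
  proof -
    have q': "q n \<in> modular_ball l \<Phi> w \<rho>" for n using q by blast
    obtain p and r :: "nat \<Rightarrow> nat" where p: "p \<in> modular_ball l \<Phi> w \<rho>" "strict_mono r"
      and lim: "\<And>m. (\<lambda>n. q (r n) m) \<longlonglongrightarrow> p m"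
      using modular_ball_seq_compact[where q = q, OF c l \<rho> q'] by blast
    have lim0: "(\<lambda>n. q (r n) m - p m) \<longlonglongrightarrow> 0" for m using lim[of m] by (simp add: LIM_zero)
    have "eventually (\<lambda>n. (q \<circ> r) n \<in> s_space k \<Phi> w \<and> s_dist k \<Phi> w ((q \<circ> r) n) p < \<epsilon>) sequentially"
      if "\<epsilon> > 0" for \<epsilon>
    proof -
      \<comment> \<open>Halving \<epsilon> turns the non-strict norm bound into the strict one
        required for metric convergence.\<close>
      have "eventually (\<lambda>n. s_norm k \<Phi> w (\<lambda>m. q (r n) m - p m) \<le> \<epsilon> / 2) sequentially"
        using that \<rho> by (intro eventually_s_norm_le[OF kl, of "2 * \<rho>"] modular_ball_diff q' p lim0) auto
      then show ?thesis
        by eventually_elim (use that sub p(1) q' in \<open>auto simp: s_dist_def\<close>)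
    qed
    then have "limitin mtopology (q \<circ> r) p sequentially"
      using p(1) sub unfolding limitin_metric by blast
    with p show ?thesis by blast
  qed
  with sub show ?thesis unfolding s_topology_def compactin_sequentially by blast
qed

text \<open>A norm-bounded set lies in a modular ball. That ball is compact, hence closed in the
  Hausdorff topology, so it contains the closure of the set.\<close>

lemma compact_embedding_of_less:
  assumes "0 \<le> k" "k < l"
  shows "compact_embedding l \<Phi> k \<Phi> w"
  unfolding compact_embedding_def
proof (intro conjI allI impI)
  show "s_space l \<Phi> w \<subseteq> s_space k \<Phi> w" using assms by (simp add: s_space_mono)
  interpret Metric_space "s_space k \<Phi> w" "s_dist k \<Phi> w"
    by (rule Metric_space_s_space[OF orl w_pos])
  fix B assume "s_bounded l \<Phi> w B"
  then obtain C where B: "B \<subseteq> s_space l \<Phi> w" "\<And>p. p \<in> B \<Longrightarrow> s_norm l \<Phi> w p \<le> C"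
    by (auto simp: s_bounded_def)
  \<comment> \<open>The radius has to be positive and strictly larger than \<open>C\<close>.\<close>
  have sub: "B \<subseteq> modular_ball l \<Phi> w (max 1 (C + 1))"
    using B by (force intro: modular_ball_if_s_norm_less)
  have K: "compactin (s_topology k \<Phi> w) (modular_ball l \<Phi> w (max 1 (C + 1)))"
    by (intro compactin_modular_ball assms) simp
  then have "closedin (s_topology k \<Phi> w) (modular_ball l \<Phi> w (max 1 (C + 1)))"
    unfolding s_topology_def by (rule compactin_imp_closedin[OF Hausdorff_space_mtopology])
  from closure_of_minimal[OF sub this]
  show "compactin (s_topology k \<Phi> w) (s_topology k \<Phi> w closure_of B)"
    by (rule closed_compactin[OF K]) simp
qed

end

end

section \<open>Composition of a compact and a continuous embedding\<close>

text \<open>The closure of \<open>B\<close> in the intermediate space is compact and remains so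
  under the continuous inclusion. It is then closed in the Hausdorff target and contains the closure
  of \<open>B\<close> taken there.\<close>

lemma compact_continuous_embedding:
  assumes orl: "orlicz \<Psi>" "orlicz \<Phi>" and w_pos: "\<And>m. w m > 0"
    and comp: "compact_embedding k' \<Theta> k \<Psi> w" and cont: "continuous_embedding k \<Psi> l \<Phi> w"
  shows "compact_embedding k' \<Theta> l \<Phi> w"
  unfolding compact_embedding_def
proof (intro conjI allI impI)
  interpret X: Metric_space "s_space k \<Psi> w" "s_dist k \<Psi> w"
    by (rule Metric_space_s_space[OF orl(1) w_pos])
  interpret Y: Metric_space "s_space l \<Phi> w" "s_dist l \<Phi> w"
    by (rule Metric_space_s_space[OF orl(2) w_pos])
  from cont obtain C where sub: "s_space k \<Psi> w \<subseteq> s_space l \<Phi> w"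
    and C: "\<And>p. p \<in> s_space k \<Psi> w \<Longrightarrow> s_norm l \<Phi> w p \<le> C * s_norm k \<Psi> w p"
    by (auto simp: continuous_embedding_def)
  show "s_space k' \<Theta> w \<subseteq> s_space l \<Phi> w" using comp sub by (auto simp: compact_embedding_def)
  have "continuous_map X.mtopology Y.mtopology (\<lambda>p. p)"
    unfolding X.metric_continuous_map[OF Y.Metric_space_axioms]
  proof (intro conjI ballI allI impI)
    fix p and \<epsilon> :: real assume p: "p \<in> s_space k \<Psi> w" and \<epsilon>: "\<epsilon> > 0"
    \<comment> \<open>The divisor \<open>\<bar>C\<bar> + 1\<close> is positive whatever the sign of
      \<open>C\<close>.\<close>
    have "s_dist l \<Phi> w p q < \<epsilon>" if q: "q \<in> s_space k \<Psi> w" "s_dist k \<Psi> w p q < \<epsilon> / (\<bar>C\<bar> + 1)" for q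
    proof -
      have "s_dist l \<Phi> w p q = s_norm l \<Phi> w (\<lambda>m. p m - q m)"
        using p q sub by (auto simp: s_dist_def)
      also have "\<dots> \<le> C * s_norm k \<Psi> w (\<lambda>m. p m - q m)"
        by (rule C[OF s_space_diff[OF orl(1) w_pos p q(1)]])
      also have "\<dots> = C * s_dist k \<Psi> w p q" using p q by (simp add: s_dist_def)
      also have "\<dots> \<le> (\<bar>C\<bar> + 1) * s_dist k \<Psi> w p q" by (intro mult_right_mono) auto
      also have "\<dots> < \<epsilon>" using q(2) by (simp add: field_simps)
      finally show ?thesis .
    qed
    then show "\<exists>\<delta>>0. \<forall>q. q \<in> s_space k \<Psi> w \<and> s_dist k \<Psi> w p q < \<delta> \<longrightarrow> s_dist l \<Phi> w p q < \<epsilon>"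
      using \<epsilon> by (intro exI[of _ "\<epsilon> / (\<bar>C\<bar> + 1)"]) auto
  qed (use sub in auto)
  then have cmap: "continuous_map (s_topology k \<Psi> w) (s_topology l \<Phi> w) (\<lambda>p. p)"
    by (simp add: s_topology_def)
  fix B assume B: "s_bounded k' \<Theta> w B"
  define K where "K = s_topology k \<Psi> w closure_of B"
  have "compactin (s_topology k \<Psi> w) K" using comp B by (auto simp: compact_embedding_def K_def)
  from image_compactin[OF this cmap] have K: "compactin (s_topology l \<Phi> w) K" by simp
  then have "closedin (s_topology l \<Phi> w) K"
    unfolding s_topology_def by (rule compactin_imp_closedin[OF Y.Hausdorff_space_mtopology])
  moreover have "B \<subseteq> topspace (s_topology k \<Psi> w)"
    using B comp by (auto simp: s_bounded_def compact_embedding_def s_topology_def)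
  then have "B \<subseteq> K" unfolding K_def by (rule closure_of_subset)
  ultimately have "s_topology l \<Phi> w closure_of B \<subseteq> K" by (intro closure_of_minimal)
  then show "compactin (s_topology l \<Phi> w) (s_topology l \<Phi> w closure_of B)"
    by (rule closed_compactin[OF K]) simp
qed

section \<open>Continuous embeddings by comparison of modulars\<close>

text \<open>This reduces norm estimates to ball inclusions: after division by \<open>a\<close> the
  left side is a lower bound of the radii whose infimum is the norm on the right.\<close>

lemma s_norm_le_mult:
  assumes orl: "orlicz \<Psi>" "orlicz \<Phi>" and w_pos: "\<And>m. w m > 0" and "a > 0"
    and p: "p \<in> s_space k \<Psi> w"
    and ball: "\<And>\<rho>. \<rho> > 0 \<Longrightarrow> p \<in> modular_ball k \<Psi> w \<rho> \<Longrightarrow> p \<in> modular_ball l \<Phi> w (a * \<rho>)"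
  shows "s_norm l \<Phi> w p \<le> a * s_norm k \<Psi> w p"
proof -
  have "s_norm l \<Phi> w p / a \<le> s_norm k \<Psi> w p"
    unfolding s_norm_eq_Inf_ball[of \<Psi> w, OF orl(1) w_pos]
  proof (rule cInf_greatest[OF ex_modular_ball[OF orl(1) w_pos p]])
    fix \<rho> assume "\<rho> \<in> {\<rho>. \<rho> > 0 \<and> p \<in> modular_ball k \<Psi> w \<rho>}"
    with ball[of \<rho>] \<open>a > 0\<close> have "s_norm l \<Phi> w p \<le> a * \<rho>"
      by (intro s_norm_le[OF orl(2) w_pos]) auto
    with \<open>a > 0\<close> show "s_norm l \<Phi> w p / a \<le> \<rho>" by (simp add: field_simps)
  qed
  with \<open>a > 0\<close> show ?thesis by (simp add: field_simps)
qed

text \<open>The modular terms compare at the same scale: the base of the weight factor grows from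
  \<Phi> to \<Psi>, and, being at least 1, its power grows from \<open>l\<close> to
  \<open>k\<close>. The embedding constant is therefore 1.\<close>

lemma continuous_embedding_of_le:
  assumes orl: "orlicz \<Psi>" "orlicz \<Phi>" and w_pos: "\<And>m. w m > 0"
    and le: "\<And>t. t \<ge> 0 \<Longrightarrow> \<Phi> t \<le> \<Psi> t" and k: "0 \<le> l" "l \<le> k"
  shows "continuous_embedding k \<Psi> l \<Phi> w"
proof -
  have mono: "modular_term l \<Phi> w p \<rho> m \<le> modular_term k \<Psi> w p \<rho> m" if "\<rho> > 0" for p \<rho> m
  proof -
    have "(1 + \<Phi> \<bar>real_of_int m\<bar>) powr l \<le> (1 + \<Psi> \<bar>real_of_int m\<bar>) powr l"
      using le[of "\<bar>real_of_int m\<bar>"] orlicz_nonneg[of \<Phi> w "\<bar>real_of_int m\<bar>", OF orl(2) w_pos] k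
      by (intro powr_mono2) auto
    also have "\<dots> \<le> (1 + \<Psi> \<bar>real_of_int m\<bar>) powr k"
      by (rule factor_mono[OF orl(1) w_pos k(2)])
    finally show ?thesis
      unfolding modular_term_def using le[of "cmod (p m) / \<rho>"] that w_pos[of m]
        orlicz_nonneg[of \<Phi> w "cmod (p m) / \<rho>", OF orl(2) w_pos]
      by (intro mult_mono mult_left_mono) auto
  qed
  show ?thesis
    unfolding continuous_embedding_def
  proof (intro conjI exI ballI)
    show "s_space k \<Psi> w \<subseteq> s_space l \<Phi> w"
      unfolding s_space_def
      by (auto intro: summable_on_comparison_test mono modular_term_nonneg[OF orl(2) w_pos])
    fix p assume p: "p \<in> s_space k \<Psi> w"
    show "s_norm l \<Phi> w p \<le> 1 * s_norm k \<Psi> w p"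
    proof (rule s_norm_le_mult[OF orl w_pos _ p])
      fix \<rho> :: real assume "\<rho> > 0" "p \<in> modular_ball k \<Psi> w \<rho>"
      then show "p \<in> modular_ball l \<Phi> w (1 * \<rho>)"
        by (simp add: modular_ball_transfer mono)
    qed auto
  qed
qed

text \<open>Each index in the set adds at least \<open>e\<close> to a partial sum, which bounds the
  size of finite subsets by \<open>infsum f UNIV / e\<close>.\<close>

lemma finite_ge_if_summable_on:
  fixes f :: "'a \<Rightarrow> real"
  assumes "f summable_on UNIV" "\<And>x. f x \<ge> 0" "e > 0"
  shows "finite {x. f x \<ge> e}"
proof -
  obtain n :: nat where n: "infsum f UNIV < real n * e"
    using reals_Archimedean3[OF assms(3)] by blast
  have "card G \<le> n" if G: "G \<subseteq> {x. f x \<ge> e}" "finite G" for G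
  proof -
    have "real (card G) * e = (\<Sum>x\<in>G. e)" by simp
    also have "\<dots> \<le> sum f G" using G by (intro sum_mono) auto
    also have "\<dots> \<le> infsum f UNIV" using G assms by (intro finite_sum_le_infsum) auto
    finally have "real (card G) * e < real n * e" using n by simp
    then show ?thesis using assms(3) by simp
  qed
  then show ?thesis by (rule finite_if_finite_subsets_card_bdd[THEN conjunct1])
qed

text \<open>Ball inclusions give summability at large scales only, so membership is proved
  separately at each scale. The comparison can fail only where \<open>cmod (p m) / \<rho>\<close>
  exceeds \<open>t0\<close>; such indices contribute a fixed positive amount to a summable family,
  so there are finitely many.\<close>

lemma s_space_subset_of_le_near_0:
  assumes orl: "orlicz \<Psi>" "orlicz \<Phi>" and w_pos: "\<And>m. w m > 0"
    and c: "c > 0" "\<And>m. c \<le> w m"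
    and le: "\<gamma> > 0" "t0 > 0" "\<And>t. 0 \<le> t \<Longrightarrow> t \<le> t0 \<Longrightarrow> \<Phi> t \<le> \<Psi> (\<gamma> * t)" and k: "0 \<le> k"
  shows "s_space k \<Psi> w \<subseteq> s_space 0 \<Phi> w"
proof
  fix p assume p: "p \<in> s_space k \<Psi> w"
  show "p \<in> s_space 0 \<Phi> w"
    unfolding s_space_def
  proof (intro CollectI allI impI)
    fix \<rho> :: real assume \<rho>: "\<rho> > 0"
    \<comment> \<open>The scale \<open>\<rho> / \<gamma>\<close> absorbs the dilation: \<gamma>
      times \<open>cmod (p m) / \<rho>\<close> equals
      \<open>cmod (p m) / (\<rho> / \<gamma>)\<close>.\<close>
    let ?f = "modular_term k \<Psi> w p (\<rho> / \<gamma>)"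
    have factor: "w m \<le> w m * (1 + \<Psi> \<bar>real_of_int m\<bar>) powr k" for m
      using mult_left_mono[OF factor_mono[OF orl(1) w_pos k, of m], of "w m"] w_pos[of m]
        orlicz_nonneg[of \<Psi> w "\<bar>real_of_int m\<bar>", OF orl(1) w_pos] by simp
    have sf: "?f summable_on UNIV" using p \<rho> le(1) by (simp add: s_space_def)
    \<comment> \<open>Defining the exceptional set by the size of the summable term makes finiteness
      immediate; it contains all indices with argument above \<open>t0\<close>.\<close>
    define E where "E = {m. c * \<Psi> (\<gamma> * t0) \<le> ?f m}"
    have pos: "c * \<Psi> (\<gamma> * t0) > 0" using orl(1) c le by (simp add: orlicz_def)
    have fin: "finite E"
      unfolding E_def using \<rho> le(1)
      by (intro finite_ge_if_summable_on sf modular_term_nonneg[OF orl(1) w_pos] pos) auto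
    have "modular_term 0 \<Phi> w p \<rho> m \<le> ?f m" if "m \<notin> E" for m
    proof -
      have small: "cmod (p m) / \<rho> \<le> t0"
      proof (rule ccontr)
        assume "\<not> cmod (p m) / \<rho> \<le> t0"
        then have "\<gamma> * t0 \<le> cmod (p m) / (\<rho> / \<gamma>)" using le(1) \<rho> by (simp add: field_simps)
        then have "\<Psi> (\<gamma> * t0) \<le> \<Psi> (cmod (p m) / (\<rho> / \<gamma>))"
          using le by (intro orlicz_mono[of \<Psi> w, OF orl(1) w_pos]) auto
        then have "c * \<Psi> (\<gamma> * t0) \<le> ?f m"
          unfolding modular_term_def using order_trans[OF c(2) factor, of m] c(1) le w_pos[of m]
          by (intro mult_mono orlicz_nonneg[of \<Psi> w, OF orl(1) w_pos]) auto
        with that show False by (simp add: E_def)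
      qed
      have "modular_term 0 \<Phi> w p \<rho> m = w m * \<Phi> (cmod (p m) / \<rho>)"
        using orlicz_nonneg[of \<Phi> w "\<bar>real_of_int m\<bar>", OF orl(2) w_pos] by (simp add: modular_term_def)
      also have "\<dots> \<le> ?f m"
        unfolding modular_term_def using le(3)[OF _ small] \<rho> factor[of m] w_pos[of m]
          orlicz_nonneg[of \<Phi> w "cmod (p m) / \<rho>", OF orl(2) w_pos]
        by (intro mult_mono) (auto simp: mult_ac)
      finally show ?thesis .
    qed
    then have "modular_term 0 \<Phi> w p \<rho> summable_on (- E)"
      using modular_term_nonneg[OF orl(2) w_pos \<rho>]
      by (intro summable_on_comparison_test[OF summable_on_subset_banach[OF sf]]) auto
    then have "modular_term 0 \<Phi> w p \<rho> summable_on (- E \<union> E)"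
      using fin by (intro summable_on_Un_disjoint) auto
    then show "modular_term 0 \<Phi> w p \<rho> summable_on UNIV" by simp
  qed
qed

lemma continuous_embedding_of_le_near_0:
  assumes orl: "orlicz \<Psi>" "orlicz \<Phi>" and w_pos: "\<And>m. w m > 0"
    and c: "c > 0" "\<And>m. c \<le> w m"
    and le: "\<gamma> > 0" "t0 > 0" "\<And>t. 0 \<le> t \<Longrightarrow> t \<le> t0 \<Longrightarrow> \<Phi> t \<le> \<Psi> (\<gamma> * t)" and k: "0 \<le> k"
  shows "continuous_embedding k \<Psi> 0 \<Phi> w"
proof -
  obtain R where R: "R > 0"
    "\<And>\<rho> p m. \<rho> > 0 \<Longrightarrow> p \<in> modular_ball k \<Psi> w \<rho> \<Longrightarrow> cmod (p m) / \<rho> \<le> R"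
    using modular_ball_ptwise_le[of \<Psi> w, OF orl(1) w_pos c k] by blast
  \<comment> \<open>The bound \<open>R / t0\<close> brings every rescaled argument into
    \<open>[0, t0]\<close>, and the bound \<gamma> lets the rescaling absorb the dilation inside
    \<Psi>.\<close>
  define a where "a = max \<gamma> (R / t0)"
  have a: "a > 0" "\<gamma> \<le> a" "R \<le> a * t0"
    using le R(1) by (auto simp: a_def field_simps max_def)
  have "p \<in> modular_ball 0 \<Phi> w (a * \<rho>)" if \<rho>: "\<rho> > 0" and p: "p \<in> modular_ball k \<Psi> w \<rho>" for p \<rho>
  proof -
    have "modular_term 0 \<Phi> w p (a * \<rho>) m \<le> modular_term k \<Psi> w p \<rho> m" for m
    proof -
      have "cmod (p m) \<le> R * \<rho>" using R(2)[OF \<rho> p, of m] \<rho> by (simp add: field_simps)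
      also have "\<dots> \<le> t0 * (a * \<rho>)" using a(3) \<rho> by (simp add: mult_ac)
      finally have small: "cmod (p m) / (a * \<rho>) \<le> t0" using a \<rho> by (simp add: field_simps)
      have "\<Phi> (cmod (p m) / (a * \<rho>)) \<le> \<Psi> (\<gamma> * (cmod (p m) / (a * \<rho>)))"
        using a \<rho> by (intro le(3) small) auto
      also have "\<dots> \<le> \<Psi> (cmod (p m) / \<rho>)"
      proof (rule orlicz_mono[of \<Psi> w, OF orl(1) w_pos])
        have "\<gamma> * cmod (p m) \<le> a * cmod (p m)" using a by (intro mult_right_mono) auto
        then show "\<gamma> * (cmod (p m) / (a * \<rho>)) \<le> cmod (p m) / \<rho>"
          using a \<rho> by (simp add: field_simps)
      qed (use le a \<rho> in auto)
      finally have "\<Phi> (cmod (p m) / (a * \<rho>)) \<le> \<Psi> (cmod (p m) / \<rho>)" .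
      moreover have "(1 + \<Phi> \<bar>real_of_int m\<bar>) powr 0 \<le> (1 + \<Psi> \<bar>real_of_int m\<bar>) powr k"
        using factor_mono[OF orl(1) w_pos k, of m]
          orlicz_nonneg[of \<Psi> w "\<bar>real_of_int m\<bar>", OF orl(1) w_pos]
          orlicz_nonneg[of \<Phi> w "\<bar>real_of_int m\<bar>", OF orl(2) w_pos] by simp
      ultimately show ?thesis
        unfolding modular_term_def using w_pos[of m] a \<rho>
        by (intro mult_mono mult_left_mono orlicz_nonneg[of \<Phi> w, OF orl(2) w_pos]) auto
    qed
    then show ?thesis by (rule modular_ball_transfer[OF p])
  qed
  then have norm: "s_norm 0 \<Phi> w p \<le> a * s_norm k \<Psi> w p" if "p \<in> s_space k \<Psi> w" for p
    by (intro s_norm_le_mult[OF orl w_pos a(1) that]) auto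
  have "s_space k \<Psi> w \<subseteq> s_space 0 \<Phi> w"
    by (rule s_space_subset_of_le_near_0[where w = w, OF orl w_pos c le(1,2) _ k]) (rule le(3))
  with norm show ?thesis unfolding continuous_embedding_def by blast
qed

section \<open>Assembly of the embeddings in (a) and (b)\<close>

theorem theorem5:
  fixes \<Phi> \<Psi> :: "real \<Rightarrow> real" and w :: "int \<Rightarrow> real"
  assumes "orlicz \<Phi>" and "orlicz \<Psi>"
    and "Limsup (at_right 0) (\<lambda>t. ereal (\<Psi> (2 * t) / \<Psi> t)) < \<infinity>"
    and "\<And>m. w m > 0"
    and "(INF m. w m) > 0"
  shows
    "(\<forall>\<gamma> k k' k''.
        0 < \<gamma> \<and> \<gamma> \<le> 1 \<and> (\<forall>t\<ge>0. \<Phi> t \<le> \<Psi> (\<gamma> * t)) \<and> k'' > k' \<and> k' \<ge> k \<and> k \<ge> 0 \<longrightarrow>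
          compact_embedding k'' \<Psi> k' \<Psi> w \<and>
          continuous_embedding k' \<Psi> k \<Phi> w \<and>
          compact_embedding k'' \<Psi> k \<Phi> w) \<and>
     (\<forall>\<gamma> t0 k k'.
        0 < \<gamma> \<and> 0 < t0 \<and> (\<forall>t\<in>{0..t0}. \<Phi> t \<le> \<Psi> (\<gamma> * t)) \<and> k' > k \<and> k \<ge> 0 \<longrightarrow>
          compact_embedding k' \<Psi> k \<Psi> w \<and>
          continuous_embedding k \<Psi> 0 \<Phi> w \<and>
          compact_embedding k' \<Psi> 0 \<Phi> w)"
proof -
  note orl = assms(1,2) and limsup = assms(3) and w_pos = assms(4)
  \<comment> \<open>Over the reals \<open>INF\<close> is a lower bound only when the range is
    bounded below; positivity supplies the bound 0.\<close>
  have bdd: "bdd_below (range w)"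
    using less_imp_le[OF w_pos] by (intro bdd_belowI[of _ 0]) auto
  define c where "c = (INF m. w m)"
  have c: "c > 0" "\<And>m. c \<le> w m"
    unfolding c_def using assms(5) cINF_lower[OF bdd] by auto
  have comp: "compact_embedding l \<Psi> k \<Psi> w" if "0 \<le> k" "k < l" for k l
    by (rule compact_embedding_of_less[OF orl(2) w_pos limsup c that])
  show ?thesis
  proof (intro conjI allI impI; elim conjE)
    fix \<gamma> k k' k'' :: real
    assume \<gamma>: "0 < \<gamma>" "\<gamma> \<le> 1" "\<forall>t\<ge>0. \<Phi> t \<le> \<Psi> (\<gamma> * t)" and k: "k'' > k'" "k' \<ge> k" "k \<ge> 0"
    \<comment> \<open>Since \<gamma> is at most 1, monotonicity of \<Psi> removes the
      dilation.\<close>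
    have "\<Phi> t \<le> \<Psi> t" if "t \<ge> 0" for t
    proof -
      have "\<Phi> t \<le> \<Psi> (\<gamma> * t)" using \<gamma>(3) that by simp
      also have "\<dots> \<le> \<Psi> t"
        using \<gamma> that by (intro orlicz_mono[of \<Psi> w, OF orl(2) w_pos] mult_left_le_one_le) auto
      finally show ?thesis .
    qed
    then show cont: "continuous_embedding k' \<Psi> k \<Phi> w"
      by (rule continuous_embedding_of_le[OF orl(2,1) w_pos _ k(3,2)])
    show com: "compact_embedding k'' \<Psi> k' \<Psi> w" using k by (intro comp) auto
    show "compact_embedding k'' \<Psi> k \<Phi> w"
      by (rule compact_continuous_embedding[OF orl(2,1) w_pos com cont])
  next
    fix \<gamma> t0 k k' :: real
    assume \<gamma>: "0 < \<gamma>" "0 < t0" "\<forall>t\<in>{0..t0}. \<Phi> t \<le> \<Psi> (\<gamma> * t)" and k: "k' > k" "k \<ge> 0"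
    show cont: "continuous_embedding k \<Psi> 0 \<Phi> w"
      by (rule continuous_embedding_of_le_near_0[OF orl(2,1) w_pos c \<gamma>(1,2) _ k(2)])
        (use \<gamma>(3) in auto)
    show com: "compact_embedding k' \<Psi> k \<Psi> w" using k by (intro comp) auto
    show "compact_embedding k' \<Psi> 0 \<Phi> w"
      by (rule compact_continuous_embedding[OF orl(2,1) w_pos com cont])
  qed
qed

end
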